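(* Consider anti-dominance range skyline queries on $n$ points in $\mathbb{R}^2$. Any linear-size structure under the indexability model (i.e., any structure of at most $cn/B$ blocks for some constant $c\ge 1$) must incur $\Omega((n/B)^{\epsilon}+k/B)$ I/Os to answer a query in the worst case, where $\epsilon>0$ is a constant (which can be arbitrarily small, depending on the constant $c$ of the linear space bound) and $k$ is the result size.
   Context: For distinct points $p=(x_p,y_p)$, $q=(x_q,y_q)$ in $\mathbb{R}^2$, $p$ dominates $q$ if $x_p\ge x_q$ and $y_p\ge y_q$. The skyline of a finite point set consists of its points not dominated by any other point of the set. A range skyline query with axis-parallel rectangle $Q$ on a point set $P$ reports the skyline of $P\cap Q$. It is an anti-dominance query if the bottom and left edges of $Q$ are grounded, i.e., $Q=\,]-\infty,\alpha]\times\,]-\infty,\beta]$. Indexability model (Hellerstein et al.): a structure on a point set $P$ is a collection of blocks, each containing at most $B$ points of $P$ (a point may be stored in several blocks). Its space is the number of blocks. A query is answered by selecting a set of blocks whose union contains all points of the query result; the cost (number of I/Os) of the query is the minimum number of blocks in such a set (locating the blocks is free). *)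

theory Defs
  imports "HOL-Library.Extended_Real"
begin

definition dominates :: "real \<times> real \<Rightarrow> real \<times> real \<Rightarrow> bool" where
  "dominates p q \<longleftrightarrow> p \<noteq> q \<and> fst p \<ge> fst q \<and> snd p \<ge> snd q"

definition skyline :: "(real \<times> real) set \<Rightarrow> (real \<times> real) set" where
  "skyline S = {p \<in> S. \<not> (\<exists>q\<in>S. dominates q p)}"

definition range_skyline :: "(real \<times> real) set \<Rightarrow> (real \<times> real) set \<Rightarrow> (real \<times> real) set" where
  "range_skyline P Q = skyline (P \<inter> Q)"

definition anti_dominance_range :: "real \<Rightarrow> real \<Rightarrow> (real \<times> real) set" where
  "anti_dominance_range \<alpha> \<beta> = {..\<alpha>} \<times> {..\<beta>}"

text \<open>
  A structure is a set of blocks; as blocks are subsets of the finite set \<open>P\<close>, it is finite and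
  its space is its cardinality. That the blocks cover \<open>P\<close> is not required: an uncovered result
  has infinite cost below, since the infimum of the empty set in \<^typ>\<open>enat\<close> is \<open>\<infinity>\<close>.
\<close>
definition indexability_structure ::
    "nat \<Rightarrow> (real \<times> real) set \<Rightarrow> (real \<times> real) set set \<Rightarrow> bool" where
  "indexability_structure B P D \<longleftrightarrow> finite P \<and> (\<forall>b\<in>D. b \<subseteq> P \<and> card b \<le> B)"

definition io_cost :: "(real \<times> real) set set \<Rightarrow> (real \<times> real) set \<Rightarrow> enat" where
  "io_cost D R = (INF S \<in> {S. S \<subseteq> D \<and> R \<subseteq> \<Union>S}. enat (card S))"

text \<open>
  Worst-case lower bound \<open>f k\<close> on the cost of an anti-dominance query with result size \<open>k\<close>, for
  structures of at most \<open>c n / B\<close> blocks on \<open>n\<close> points: some \<open>n\<close>-point input defeats all of them.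

  An \<open>\<Omega>((n/B)\<^sup>\<epsilon> + k/B)\<close> bound has two readings. With one hidden constant,
  \<open>f k = \<gamma> ((n/B)\<^sup>\<epsilon> + k/B)\<close>, it is already met by reporting an input that is one big staircase.
  The output-sensitive content is that a query time \<open>g(n,B) + a k/B\<close>, whatever the constant \<open>a\<close>,
  forces \<open>g(n,B) \<ge> \<gamma> (n/B)\<^sup>\<epsilon>\<close>; this is \<open>f k = \<gamma> (n/B)\<^sup>\<epsilon> + a k/B\<close> for every \<open>a\<close>, and needs
  \<open>B\<close> large in terms of \<open>a\<close>: if \<open>B \<le> a\<close>, then \<open>a k/B \<ge> k\<close>, and \<open>k\<close> blocks always suffice in a
  structure covering the points.
\<close>
definition anti_dominance_lower_bound :: "real \<Rightarrow> nat \<Rightarrow> nat \<Rightarrow> (nat \<Rightarrow> real) \<Rightarrow> bool" where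
  "anti_dominance_lower_bound c B n f \<longleftrightarrow>
     (\<exists>P. finite P \<and> card P = n \<and>
       (\<forall>D. indexability_structure B P D \<and> real (card D) \<le> c * real n / real B \<longrightarrow>
         (\<exists>\<alpha> \<beta>. let R = range_skyline P (anti_dominance_range \<alpha> \<beta>)
                in ereal (f (card R)) \<le> ereal_of_enat (io_cost D R))))"

end

(*
  In the complemented digit-reversal set {(i, crev i) | i < w^L}, fix all base-w digits of i but the
  one at position p. The w points of such a line form an antichain, and every other point below
  their common upper corner is strictly dominated by one of them, so each of the L w^(L-1) lines is
  the answer to an anti-dominance query, and two lines meet in at most one point. Blow up every
  point to an antichain of s points, with s a small fraction of B.

  Suppose every line is answered by at most 2 a k/B blocks. Then half of its points are covered by
  blocks holding at least B/(4a) of them. A block has few such lines, and since these overlap in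
  at most s points, it accounts for at most 2B incidences, whatever a is. Each point lies on L lines,
  so L n = O(B |D|) = O(c n): any L above a constant multiple of c is contradictory, and
  \<epsilon> = 1/L does not depend on a.
*)

theory Submission
  imports Defs
begin

section \<open>Elementary lower bounds on the cost of a query\<close>

text \<open>An infimum over a nonempty set of extended naturals is attained, so a bound for every
  selection passes to the cost; if no selection exists, the cost is infinite.\<close>

lemma io_cost_geI:
  assumes "\<And>S. S \<subseteq> D \<Longrightarrow> R \<subseteq> \<Union>S \<Longrightarrow> x \<le> real (card S)"
  shows "ereal x \<le> ereal_of_enat (io_cost D R)"
proof (cases "{S. S \<subseteq> D \<and> R \<subseteq> \<Union>S} = {}")
  case True
  then have "io_cost D R = \<infinity>"
    unfolding io_cost_def by (simp only: image_empty Inf_enat_def) simp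
  then show ?thesis by simp
next
  case False
  then have "io_cost D R \<in> (\<lambda>S. enat (card S)) ` {S. S \<subseteq> D \<and> R \<subseteq> \<Union>S}"
    unfolding io_cost_def by (blast intro: wellorder_InfI)
  then obtain S where "S \<subseteq> D" "R \<subseteq> \<Union>S" "io_cost D R = enat (card S)"
    by auto
  with assms show ?thesis by simp
qed

lemma indexability_structure_finite:
  assumes "indexability_structure B P D"
  shows "finite D"
  using assms unfolding indexability_structure_def
  by (meson PowI finite_Pow_iff finite_subset subsetI)

lemma io_cost_ge_one:
  assumes "indexability_structure B P D" "R \<noteq> {}" "x \<le> 1"
  shows "ereal x \<le> ereal_of_enat (io_cost D R)"
proof (rule io_cost_geI)
  fix S assume S: "S \<subseteq> D" "R \<subseteq> \<Union>S"
  have "S \<noteq> {}" using S assms(2) by auto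
  moreover have "finite S" using S indexability_structure_finite[OF assms(1)] finite_subset by auto
  ultimately have "card S \<ge> 1" by (simp add: Suc_leI card_gt_0_iff)
  then show "x \<le> real (card S)" using assms(3) by linarith
qed

lemma io_cost_ge_div:
  assumes "indexability_structure B P D" "x \<le> real (card R) / real B" "B > 0"
  shows "ereal x \<le> ereal_of_enat (io_cost D R)"
proof (rule io_cost_geI)
  fix S assume S: "S \<subseteq> D" "R \<subseteq> \<Union>S"
  have fS: "finite S" using S indexability_structure_finite[OF assms(1)] finite_subset by auto
  have blocks: "finite b \<and> card b \<le> B" if "b \<in> S" for b
    using assms(1) S that unfolding indexability_structure_def by (meson finite_subset subsetD)
  have "card R \<le> card (\<Union>S)" using S fS blocks by (intro card_mono) auto
  also have "\<dots> \<le> (\<Sum>b\<in>S. card b)" by (rule card_Union_le_sum_card)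
  also have "\<dots> \<le> card S * B" using sum_bounded_above[of S card B] blocks by simp
  finally have "real (card R) \<le> real (card S) * real B" by (metis of_nat_le_iff of_nat_mult)
  then have "real (card R) / real B \<le> real (card S)" using assms(3) by (simp add: divide_le_eq)
  then show "x \<le> real (card S)" using assms(2) by linarith
qed

section \<open>Counting incidences between blocks and nearly disjoint query results\<close>

text \<open>Bonferroni-type estimate, by induction: inside \<open>b\<close> a new set meets the
  union of the earlier ones in at most \<open>s\<close> points per earlier set, and these losses add
  up to at most \<open>s * (card F)\<^sup>2\<close>.\<close>

lemma sum_card_Int_le:
  fixes Q :: "'i \<Rightarrow> 'a set"
  assumes "finite F" "finite b"
    and "\<And>i j. i \<in> F \<Longrightarrow> j \<in> F \<Longrightarrow> i \<noteq> j \<Longrightarrow> card (Q i \<inter> Q j \<inter> b) \<le> s"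
  shows "(\<Sum>i\<in>F. card (Q i \<inter> b)) \<le> card ((\<Union>i\<in>F. Q i) \<inter> b) + s * (card F)\<^sup>2"
  using assms(1,3)
proof (induction F rule: finite_induct)
  case empty
  then show ?case by simp
next
  case (insert k F)
  let ?U = "(\<Union>i\<in>F. Q i) \<inter> b" and ?V = "Q k \<inter> b"
  have "card (?V \<inter> ?U) \<le> card (\<Union>i\<in>F. Q k \<inter> Q i \<inter> b)"
    using insert.hyps assms(2) by (intro card_mono) auto
  also have "\<dots> \<le> (\<Sum>i\<in>F. card (Q k \<inter> Q i \<inter> b))"
    by (rule card_UN_le[OF insert.hyps(1)])
  also have "\<dots> \<le> s * card F"
    using sum_bounded_above[of F "\<lambda>i. card (Q k \<inter> Q i \<inter> b)" s] insert.prems insert.hyps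
    by (auto simp: mult.commute)
  finally have 1: "card (?V \<inter> ?U) \<le> s * card F" .
  have 2: "card ?V + card ?U = card ((\<Union>i\<in>insert k F. Q i) \<inter> b) + card (?V \<inter> ?U)"
  proof -
    have "(\<Union>i\<in>insert k F. Q i) \<inter> b = ?V \<union> ?U" by auto
    then show ?thesis using card_Un_Int[of ?V ?U] assms(2) by simp
  qed
  have IH: "(\<Sum>i\<in>F. card (Q i \<inter> b)) \<le> card ?U + s * (card F)\<^sup>2"
    using insert by auto
  have "(\<Sum>i\<in>insert k F. card (Q i \<inter> b)) = card ?V + (\<Sum>i\<in>F. card (Q i \<inter> b))"
    using insert.hyps by simp
  also have "\<dots> \<le> card ((\<Union>i\<in>insert k F. Q i) \<inter> b) + s * card F + s * (card F)\<^sup>2"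
    using 1 2 IH by linarith
  also have "\<dots> \<le> card ((\<Union>i\<in>insert k F. Q i) \<inter> b) + s * (card (insert k F))\<^sup>2"
    using insert.hyps by (simp add: power2_eq_square algebra_simps)
  finally show ?case .
qed

text \<open>Up to \<open>M\<close> members contribute at most \<open>B + s * M\<^sup>2\<close>,
  hence at most \<open>2 * B\<close>. More than \<open>M\<close> members cannot occur: any
  \<open>M\<close> of them would already contribute \<open>M * \<tau>\<close>, which exceeds
  \<open>2 * B\<close>.\<close>

lemma sum_heavy_le:
  fixes Q :: "'i \<Rightarrow> 'a set" and \<tau> :: real
  assumes "finite F" "finite b" "card b \<le> B"
    and inter: "\<And>i j. i \<in> F \<Longrightarrow> j \<in> F \<Longrightarrow> i \<noteq> j \<Longrightarrow> card (Q i \<inter> Q j \<inter> b) \<le> s"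
    and heavy: "\<And>i. i \<in> F \<Longrightarrow> \<tau> \<le> card (Q i \<inter> b)"
    and M: "2 * real B < real M * \<tau>" "s * M\<^sup>2 \<le> B"
  shows "(\<Sum>i\<in>F. card (Q i \<inter> b)) \<le> 2 * B"
proof -
  have bound: "(\<Sum>i\<in>G. card (Q i \<inter> b)) \<le> 2 * B" if "G \<subseteq> F" "card G \<le> M" for G
  proof -
    have "(\<Sum>i\<in>G. card (Q i \<inter> b)) \<le> card ((\<Union>i\<in>G. Q i) \<inter> b) + s * (card G)\<^sup>2"
      using that assms(1,2) inter by (intro sum_card_Int_le) (auto intro: finite_subset)
    moreover have "card ((\<Union>i\<in>G. Q i) \<inter> b) \<le> card b"
      using assms(2) by (intro card_mono) auto
    moreover have "s * (card G)\<^sup>2 \<le> s * M\<^sup>2"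
      using that by (simp add: power_mono)
    ultimately show ?thesis using assms(3) M(2) by linarith
  qed
  have "card F \<le> M"
  proof (rule ccontr)
    assume "\<not> card F \<le> M"
    then obtain G where G: "G \<subseteq> F" "card G = M"
      using obtain_subset_with_card_n[of M F] by auto
    have "real M * \<tau> \<le> (\<Sum>i\<in>G. real (card (Q i \<inter> b)))"
      using sum_bounded_below[of G \<tau> "\<lambda>i. real (card (Q i \<inter> b))"] G heavy by auto
    also have "\<dots> \<le> 2 * real B"
      using bound[OF G(1)] G(2) by (metis dual_order.refl of_nat_le_iff of_nat_mult of_nat_numeral of_nat_sum)
    finally show False using M(1) by simp
  qed
  then show ?thesis using bound by blast
qed

text \<open>Double counting of the pairs of a result and a block that meet in at least
  \<open>\<tau>\<close> points, weighted by the size of the intersection. Each result keeps weight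
  at least \<open>K / 2\<close>, and \<open>sum_heavy_le\<close> bounds the weight at each
  block.\<close>

lemma card_family_mult_le:
  fixes Q :: "'i \<Rightarrow> 'a set" and \<tau> :: real
  assumes "finite J" "finite D"
    and D: "\<And>b. b \<in> D \<Longrightarrow> finite b \<and> card b \<le> B"
    and K: "\<And>i. i \<in> J \<Longrightarrow> card (Q i) = K"
    and inter: "\<And>i j. i \<in> J \<Longrightarrow> j \<in> J \<Longrightarrow> i \<noteq> j \<Longrightarrow> card (Q i \<inter> Q j) \<le> s"
    and fin: "\<And>i. i \<in> J \<Longrightarrow> finite (Q i)"
    and cover: "\<And>i. i \<in> J \<Longrightarrow> \<exists>S\<subseteq>D. Q i \<subseteq> \<Union>S \<and> real (card S) * \<tau> \<le> real K / 2"
    and M: "2 * real B < real M * \<tau>" "s * M\<^sup>2 \<le> B"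
  shows "card J * K \<le> 4 * B * card D"
proof -
  have "real K / 2 \<le> real (\<Sum>b | b \<in> D \<and> \<tau> \<le> card (Q i \<inter> b). card (Q i \<inter> b))" if i: "i \<in> J" for i
  proof -
    obtain S where S: "S \<subseteq> D" "Q i \<subseteq> \<Union>S" "real (card S) * \<tau> \<le> real K / 2"
      using cover[OF i] by auto
    have fS: "finite S" using S(1) assms(2) finite_subset by auto
    have \<tau>: "\<tau> > 0"
      using M(1) by (metis linorder_not_less mult_nonneg_nonpos of_nat_0_le_iff order_le_less_trans
          mult_nonneg_nonneg zero_le_numeral)
    let ?H = "{b. b \<in> D \<and> \<tau> \<le> card (Q i \<inter> b)}"
    have "card (Q i) \<le> card (\<Union>b\<in>S. Q i \<inter> b)"
      using S fS fin[OF i] by (intro card_mono) auto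
    also have "\<dots> \<le> (\<Sum>b\<in>S. card (Q i \<inter> b))" by (rule card_UN_le[OF fS])
    finally have "real K \<le> (\<Sum>b\<in>S. real (card (Q i \<inter> b)))"
      using K[OF i] by (metis of_nat_le_iff of_nat_sum)
    \<comment> \<open>A light block contributes less than \<open>\<tau>\<close>, so a charge of
      \<open>\<tau>\<close> pays for it; only heavy blocks need their true intersection.\<close>
    also have "\<dots> \<le> (\<Sum>b\<in>S. \<tau> + (if b \<in> ?H then real (card (Q i \<inter> b)) else 0))"
      using S(1) \<tau> by (intro sum_mono) auto
    also have "\<dots> = real (card S) * \<tau> + (\<Sum>b\<in>S. if b \<in> ?H then real (card (Q i \<inter> b)) else 0)"
      by (simp add: sum.distrib)
    \<comment> \<open>Summing over all of \<open>D\<close> removes the dependence on the cover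
      \<open>S\<close>, which varies with \<open>i\<close>; this permits exchanging the two sums
      below.\<close>
    also have "(\<Sum>b\<in>S. if b \<in> ?H then real (card (Q i \<inter> b)) else 0)
        \<le> (\<Sum>b\<in>D. if b \<in> ?H then real (card (Q i \<inter> b)) else 0)"
      using S(1) assms(2) by (intro sum_mono2) auto
    also have "\<dots> = (\<Sum>b\<in>?H. real (card (Q i \<inter> b)))"
      using assms(2) by (subst sum.If_cases) (auto intro: sum.cong)
    finally show ?thesis using S(3) by simp
  qed
  then have "(\<Sum>i\<in>J. real K / 2) \<le> (\<Sum>i\<in>J. real (\<Sum>b | b \<in> D \<and> \<tau> \<le> card (Q i \<inter> b). card (Q i \<inter> b)))"
    by (rule sum_mono)
  also have "\<dots> = real (\<Sum>b\<in>D. \<Sum>i | i \<in> J \<and> \<tau> \<le> card (Q i \<inter> b). card (Q i \<inter> b))"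
    unfolding of_nat_sum by (rule sum.swap_restrict[OF assms(1,2)])
  also have "(\<Sum>b\<in>D. \<Sum>i | i \<in> J \<and> \<tau> \<le> card (Q i \<inter> b). card (Q i \<inter> b)) \<le> (\<Sum>b\<in>D. 2 * B)"
  proof (intro sum_mono sum_heavy_le[where \<tau> = \<tau> and M = M and s = s])
    fix b i j assume b: "b \<in> D" and ij: "i \<in> {i \<in> J. \<tau> \<le> card (Q i \<inter> b)}"
      "j \<in> {i \<in> J. \<tau> \<le> card (Q i \<inter> b)}" "i \<noteq> j"
    have "card (Q i \<inter> Q j \<inter> b) \<le> card (Q i \<inter> Q j)"
      using fin ij by (intro card_mono) auto
    also have "\<dots> \<le> s" using inter ij by auto
    finally show "card (Q i \<inter> Q j \<inter> b) \<le> s" .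
  qed (use assms(1) D M in auto)
  finally have "real (card J * K) \<le> real (4 * B * card D)" by (simp add: algebra_simps)
  then show ?thesis by (simp only: of_nat_le_iff)
qed

section \<open>Digit reversal with complemented digits\<close>

text \<open>
  \<open>crev w k i\<close> complements the \<open>k\<close> base-\<open>w\<close> digits of \<open>i\<close> and reverses their order.
\<close>
fun crev :: "nat \<Rightarrow> nat \<Rightarrow> nat \<Rightarrow> nat" where
  "crev w 0 i = 0"
| "crev w (Suc k) i = (w - 1 - i mod w) * w ^ k + crev w k (i div w)"

text \<open>Lexicographic comparison: a smaller leading part decides, whatever the lower part is.
  The later comparisons of numbers by their digits rest on it.\<close>

lemma digit_less: "(a::nat) < A \<Longrightarrow> b < M \<Longrightarrow> a * M + b < A * M"
proof -
  assume "a < A" "b < M"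
  then have "a * M + b < Suc a * M" by simp
  also have "\<dots> \<le> A * M" using \<open>a < A\<close> by (intro mult_le_mono1) simp
  finally show ?thesis .
qed

lemma crev_less: "w > 0 \<Longrightarrow> crev w k i < w ^ k"
  by (induction k arbitrary: i) (auto intro!: digit_less)

text \<open>Reversal exchanges the two halves of the digit string. The induction strips the lowest
  digit of \<open>l\<close>, which is also the lowest digit of the whole number.\<close>

lemma crev_split:
  assumes "w > 0" "l < w ^ p"
  shows "crev w (p + q) (h * w ^ p + l) = crev w p l * w ^ q + crev w q h"
  using assms(2)
proof (induction p arbitrary: l)
  case 0
  then show ?case by simp
next
  case (Suc p)
  have e: "h * w ^ Suc p + l = w * (h * w ^ p) + l" by simp
  have "(h * w ^ Suc p + l) mod w = l mod w" unfolding e by simp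
  moreover have "(h * w ^ Suc p + l) div w = h * w ^ p + l div w"
    unfolding e using assms(1) by simp
  moreover have "l div w < w ^ p"
    using Suc.prems assms(1) by (simp add: less_mult_imp_div_less mult.commute)
  ultimately show ?case using Suc.IH[of "l div w"]
    by (simp add: algebra_simps power_add)
qed

text \<open>The leading digit of the value gives back the lowest digit of the index, and the
  remainder gives back the other digits by induction.\<close>

lemma crev_inj:
  assumes "w > 0"
  shows "inj_on (crev w k) {..<w ^ k}"
proof (induction k)
  case 0
  then show ?case by (simp add: inj_on_def)
next
  case (Suc k)
  show ?case
  proof (rule inj_onI)
    fix i j assume ij: "i \<in> {..<w ^ Suc k}" "j \<in> {..<w ^ Suc k}" "crev w (Suc k) i = crev w (Suc k) j"
    have "w - 1 - i mod w = w - 1 - j mod w" "crev w k (i div w) = crev w k (j div w)"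
    proof -
      have *: "(crev w (Suc k) t) div w ^ k = w - 1 - t mod w \<and>
          (crev w (Suc k) t) mod w ^ k = crev w k (t div w)" for t
        using crev_less[OF assms, of k "t div w"] assms by simp
      show "w - 1 - i mod w = w - 1 - j mod w" "crev w k (i div w) = crev w k (j div w)"
        using *[of i] *[of j] ij(3) by metis+
    qed
    \<comment> \<open>Subtraction on naturals is truncated, so complementing a digit is reversible
      only with these bounds.\<close>
    moreover have "i mod w \<le> w - 1" "j mod w \<le> w - 1"
      using mod_less_divisor[OF assms, of i] mod_less_divisor[OF assms, of j] by linarith+
    moreover have "i div w \<in> {..<w ^ k}" "j div w \<in> {..<w ^ k}"
      using ij by (auto simp: less_mult_imp_div_less mult.commute)
    ultimately have "i mod w = j mod w" "i div w = j div w"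
      using Suc.IH by (auto dest: inj_onD)
    then show "i = j" by (metis div_mult_mod_eq)
  qed
qed

section \<open>Lines: the indices that differ in one digit position\<close>

text \<open>
  \<open>line w (p, h, l)\<close> fixes the digits \<open>h\<close> above and \<open>l\<close> below position \<open>p\<close>.
\<close>
definition line :: "nat \<Rightarrow> nat \<times> nat \<times> nat \<Rightarrow> nat set" where
  "line w = (\<lambda>(p, h, l). (\<lambda>d. h * w ^ Suc p + d * w ^ p + l) ` {..<w})"

lemma line_iff:
  assumes "w > 0" "l < w ^ p"
  shows "i \<in> line w (p, h, l) \<longleftrightarrow> i div w ^ Suc p = h \<and> i mod w ^ p = l"
proof
  assume "i \<in> line w (p, h, l)"
  then obtain d where d: "d < w" "i = h * w ^ Suc p + d * w ^ p + l" unfolding line_def by auto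
  have "d * w ^ p + l < w ^ Suc p" using digit_less[OF d(1) assms(2)] by simp
  then have "i div w ^ Suc p = h" using d(2) assms by (simp add: add.assoc)
  moreover have "i = (h * w + d) * w ^ p + l" using d(2) by (simp add: algebra_simps)
  then have "i mod w ^ p = l" using assms(2) by simp
  ultimately show "i div w ^ Suc p = h \<and> i mod w ^ p = l" ..
next
  assume a: "i div w ^ Suc p = h \<and> i mod w ^ p = l"
  let ?d = "i div w ^ p mod w"
  have "i div w ^ Suc p = i div w ^ p div w" by (metis div_mult2_eq power_Suc2)
  then have "i div w ^ p = h * w + ?d" using a by (metis div_mult_mod_eq)
  then have "i = (h * w + ?d) * w ^ p + l" using a by (metis div_mult_mod_eq)
  then have "i = h * w ^ Suc p + ?d * w ^ p + l" by (simp add: algebra_simps)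
  moreover have "?d < w" using assms by simp
  ultimately show "i \<in> line w (p, h, l)" unfolding line_def by auto
qed

text \<open>Indexing lines by triples keeps their count exact even for \<open>w = 1\<close>, where
  all of them are the same one-point set.\<close>

definition lines :: "nat \<Rightarrow> nat \<Rightarrow> (nat \<times> nat \<times> nat) set" where
  "lines w L = (SIGMA p:{..<L}. {..<w ^ (L - Suc p)} \<times> {..<w ^ p})"

lemma finite_lines: "finite (lines w L)"
  unfolding lines_def by (intro finite_SigmaI) auto

text \<open>Each of the \<open>L\<close> positions of the free digit contributes
  \<open>w ^ (L - 1)\<close> lines. In this form both sides count incidences of lines with indices,
  and \<open>L = 0\<close> needs no exception.\<close>

lemma card_lines: "card (lines w L) * w = L * w ^ L"
proof -
  have "card (lines w L) = (\<Sum>p<L. w ^ (L - Suc p) * w ^ p)"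
    unfolding lines_def by (subst card_SigmaI) auto
  also have "\<dots> = (\<Sum>p<L. w ^ (L - 1))"
    by (intro sum.cong refl) (simp flip: power_add)
  finally show ?thesis by (cases L) (auto simp: algebra_simps)
qed

lemma card_line:
  assumes "w > 0"
  shows "card (line w t) = w"
proof -
  obtain p h l where t: "t = (p, h, l)" by (cases t)
  have "inj_on (\<lambda>d. h * w ^ Suc p + d * w ^ p + l) {..<w}"
    using assms by (auto intro: inj_onI)
  then show ?thesis unfolding t line_def by (simp add: card_image)
qed

lemma finite_line: "finite (line w t)"
  unfolding line_def by (auto split: prod.split)

lemma line_subset:
  assumes "w > 0" "t \<in> lines w L"
  shows "line w t \<subseteq> {..<w ^ L}"
proof -
  obtain p h l where t: "t = (p, h, l)" "p < L" "h < w ^ (L - Suc p)" "l < w ^ p"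
    using assms(2) unfolding lines_def by auto
  have e: "w ^ (L - Suc p) * w ^ Suc p = w ^ L"
    using t(2) by (metis Suc_leI le_add_diff_inverse2 power_add)
  have "h * w ^ Suc p + d * w ^ p + l < w ^ L" if "d < w" for d
    using digit_less[OF t(3), of "d * w ^ p + l" "w ^ Suc p"] digit_less[OF that t(4)]
    unfolding e by (simp add: add.assoc)
  then show ?thesis unfolding t line_def by auto
qed

text \<open>With the same free position, a common index determines \<open>h\<close> and
  \<open>l\<close>, so the triples agree. With positions \<open>p < p'\<close>, two common indices
  agree in the digits above \<open>p\<close> by the first line and below \<open>p'\<close> by the
  second, hence in all digits.\<close>

lemma line_Int:
  assumes "w > 0" "t \<in> lines w L" "t' \<in> lines w L" "t \<noteq> t'"
    and "i \<in> line w t \<inter> line w t'" "j \<in> line w t \<inter> line w t'"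
  shows "i = j"
proof -
  obtain p h l where t: "t = (p, h, l)" "l < w ^ p"
    using assms(2) unfolding lines_def by auto
  obtain p' h' l' where t': "t' = (p', h', l')" "l' < w ^ p'"
    using assms(3) unfolding lines_def by auto
  have *: "i = j" if "a < b" "i div w ^ Suc a = j div w ^ Suc a" "i mod w ^ b = j mod w ^ b" for a b
  proof -
    have "w ^ Suc a dvd w ^ b" using that by (intro le_imp_power_dvd) auto
    then have "i mod w ^ Suc a = j mod w ^ Suc a"
      using that(3) by (metis mod_mod_cancel)
    then show "i = j" using that(2) by (metis div_mult_mod_eq)
  qed
  have m: "i div w ^ Suc p = h" "i mod w ^ p = l" "j div w ^ Suc p = h" "j mod w ^ p = l"
    "i div w ^ Suc p' = h'" "i mod w ^ p' = l'" "j div w ^ Suc p' = h'" "j mod w ^ p' = l'"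
    using assms(5,6) t t' line_iff[OF assms(1)] by auto
  have "p \<noteq> p'" using m t t' assms(4) by auto
  then consider "p < p'" | "p' < p" by linarith
  then show ?thesis using *[of p p'] *[of p' p] m by cases simp_all
qed

section \<open>Lines as skylines below their upper corners\<close>

text \<open>The digits \<open>l\<close>, least significant in the index, lead in the second
  coordinate, and \<open>h\<close> moves to the end. The free digit stays between them but is
  complemented, so along a line one coordinate rises as the other falls.\<close>

lemma crev_digits:
  assumes "w > 0" "p < L" "e < w" "l < w ^ p"
  shows "crev w L (h * w ^ Suc p + e * w ^ p + l) =
    crev w p l * w ^ Suc (L - Suc p) + ((w - 1 - e) * w ^ (L - Suc p) + crev w (L - Suc p) h)"
proof -
  have L: "L = p + Suc (L - Suc p)" using assms(2) by simp
  have i: "h * w ^ Suc p + e * w ^ p + l = (h * w + e) * w ^ p + l"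
    by (simp add: algebra_simps)
  have "crev w L (h * w ^ Suc p + e * w ^ p + l) =
      crev w p l * w ^ Suc (L - Suc p) + crev w (Suc (L - Suc p)) (h * w + e)"
    unfolding i by (subst L) (rule crev_split[OF assms(1,4)])
  then show ?thesis using assms(1,3) by simp
qed

lemma line_antichain:
  assumes "w > 0" "t \<in> lines w L" "i \<in> line w t" "j \<in> line w t" "i < j"
  shows "crev w L j < crev w L i"
proof -
  obtain p h l where t: "t = (p, h, l)" "p < L" "l < w ^ p"
    using assms(2) unfolding lines_def by auto
  obtain d where d: "d < w" "i = h * w ^ Suc p + d * w ^ p + l"
    using assms(3) unfolding t line_def by auto
  obtain e where e: "e < w" "j = h * w ^ Suc p + e * w ^ p + l"
    using assms(4) unfolding t line_def by auto
  have "d < e" using assms(1,5) d e by simp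
  then have "w - 1 - e < w - 1 - d" using e(1) by linarith
  then show ?thesis
    unfolding d(2) e(2) crev_digits[OF assms(1) t(2) d(1) t(3)] crev_digits[OF assms(1) t(2) e(1) t(3)]
    using assms(1) by simp
qed

text \<open>Below the corner the high part of \<open>i\<close> is at most \<open>h\<close> and the
  reversed low part at most that of \<open>l\<close>; off the line, one of the two is strictly
  smaller. That one settles its coordinate against every point of the line, and the free digit is
  then chosen to win the other. Strictness in both coordinates is what survives the later
  blow-up.\<close>

lemma line_maximal:
  assumes "w > 0" "t \<in> lines w L"
  obtains xm ym where "xm < w ^ L"
    "\<And>i. i \<in> line w t \<Longrightarrow> i \<le> xm \<and> crev w L i \<le> ym"
    "\<And>i. i < w ^ L \<Longrightarrow> i \<notin> line w t \<Longrightarrow> i \<le> xm \<Longrightarrow> crev w L i \<le> ym \<Longrightarrow>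
       \<exists>j\<in>line w t. i < j \<and> crev w L i < crev w L j"
proof -
  obtain p h l where t: "t = (p, h, l)" "p < L" "h < w ^ (L - Suc p)" "l < w ^ p"
    using assms(2) unfolding lines_def by auto
  define q where "q = L - Suc p"
  define g where "g d = h * w ^ Suc p + (d * w ^ p + l)" for d
  have line: "line w t = g ` {..<w}" unfolding t line_def g_def by (simp add: add.assoc)
  have crev: "crev w L (h' * w ^ Suc p + (e * w ^ p + l')) =
      crev w p l' * w ^ Suc q + ((w - 1 - e) * w ^ q + crev w q h')" if "e < w" "l' < w ^ p" for h' e l'
    using crev_digits[OF assms(1) t(2) that] unfolding q_def by (simp add: add.assoc)
  have low: "e * w ^ p + l' < w ^ Suc p" if "e < w" "l' < w ^ p" for e l'
    using digit_less[OF that] by simp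
  have rlow: "(w - 1 - e) * w ^ q + crev w q h' < w ^ Suc q" for e h'
    using digit_less[of "w - 1 - e" w "crev w q h'" "w ^ q"] crev_less[OF assms(1)] assms(1) by simp
  \<comment> \<open>The index is largest for free digit \<open>w - 1\<close>, the reversed value for
    free digit \<open>0\<close>; the corner combines the two.\<close>
  define xm where "xm = g (w - 1)"
  define ym where "ym = crev w L (g 0)"
  have w0: "0 < w" "w - 1 < w" using assms(1) by auto
  have g: "g d \<in> line w t" if "d < w" for d using that line by auto
  show ?thesis
  proof (rule that[of xm ym])
    show "xm < w ^ L" using line_subset[OF assms] g[OF w0(2)] unfolding xm_def by auto
  next
    fix i assume "i \<in> line w t"
    then obtain d where d: "d < w" "i = g d" unfolding line by auto
    have "d * w ^ p \<le> (w - 1) * w ^ p" using d(1) by (intro mult_le_mono1) simp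
    moreover have "(w - 1 - d) * w ^ q \<le> (w - 1 - 0) * w ^ q" by (intro mult_le_mono1) simp
    ultimately show "i \<le> xm \<and> crev w L i \<le> ym"
      unfolding d(2) xm_def ym_def g_def crev[OF d(1) t(4)] crev[OF w0(1) t(4)] by simp
  next
    fix i assume i: "i < w ^ L" "i \<notin> line w t" "i \<le> xm" "crev w L i \<le> ym"
    define h' where "h' = i div w ^ Suc p"
    define e where "e = i div w ^ p mod w"
    define l' where "l' = i mod w ^ p"
    have e: "e < w" and l': "l' < w ^ p" using assms(1) unfolding e_def l'_def by auto
    have "i \<in> line w (p, h', l')" using line_iff[OF assms(1) l'] unfolding h'_def l'_def by simp
    then have ne: "h' \<noteq> h \<or> l' \<noteq> l" using i(2) t(1) by auto
    have "i div w ^ Suc p = i div w ^ p div w" by (metis div_mult2_eq power_Suc2)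
    then have "i div w ^ p = h' * w + e" unfolding h'_def e_def by (metis div_mult_mod_eq)
    then have "i = (h' * w + e) * w ^ p + l'" unfolding l'_def by (metis div_mult_mod_eq)
    then have ieq: "i = h' * w ^ Suc p + (e * w ^ p + l')" by (simp add: algebra_simps)
    have "w ^ L = w ^ (L - Suc p) * w ^ Suc p"
      using t(2) by (metis Suc_leI le_add_diff_inverse2 power_add)
    then have h'less: "h' < w ^ q"
      using i(1) unfolding h'_def q_def by (metis less_mult_imp_div_less)
    have x_lt: "i < g d" if "h' < h" "d < w" for d
      unfolding ieq g_def by (rule digit_less[OF that(1) low[OF e l'], THEN order.strict_trans2]) simp
    let ?u' = "crev w p l'" and ?u = "crev w p l"
    have y_lt: "crev w L i < crev w L (g d)" if "?u' < ?u" "d < w" for d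
      unfolding ieq g_def crev[OF e l'] crev[OF that(2) t(4)]
      by (rule digit_less[OF that(1) rlow, THEN order.strict_trans2]) simp
    have hle: "h' \<le> h"
    proof (rule ccontr)
      assume "\<not> h' \<le> h"
      then have "xm < i"
        using digit_less[OF _ low[OF w0(2) t(4)], of h h'] unfolding xm_def g_def ieq by simp
      then show False using i(3) by simp
    qed
    have ule: "?u' \<le> ?u"
    proof (rule ccontr)
      assume "\<not> ?u' \<le> ?u"
      then have "ym < crev w L i"
        using digit_less[OF _ rlow[of 0 h], of ?u ?u']
        unfolding ym_def g_def ieq crev[OF e l'] crev[OF w0(1) t(4)] by simp
      then show False using i(4) by simp
    qed
    show "\<exists>j\<in>line w t. i < j \<and> crev w L i < crev w L j"
    proof (cases "?u' = ?u")
      case False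
      then have u: "?u' < ?u" using ule by simp
      show ?thesis
      proof (cases "h' = h")
        case False
        then have "h' < h" using hle by simp
        then show ?thesis using x_lt y_lt[OF u] w0(1) g by blast
      next
        case h: True
        \<comment> \<open>All points of the line are above \<open>i\<close>, so the next larger free
          digit wins. If \<open>e\<close> is already maximal, \<open>i \<le> xm\<close> gives
          \<open>l' \<le> l\<close>, and equality is excluded by \<open>u\<close>.\<close>
        have "\<exists>d<w. i < g d"
        proof (cases "e = w - 1")
          case True
          have "l' < l" using i(3) u unfolding xm_def g_def ieq h True
            by (metis add_le_cancel_left le_neq_implies_less less_irrefl)
          then show ?thesis using w0(2) unfolding ieq g_def h True by auto
        next
          case False
          then have "e + 1 < w" using e by simp
          moreover have "i < g (e + 1)"
            using l' unfolding ieq g_def h by (simp add: algebra_simps)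
          ultimately show ?thesis by blast
        qed
        then show ?thesis using y_lt[OF u] g by blast
      qed
    next
      case u: True
      then have l: "l' = l" using crev_inj[OF assms(1), of p] t(4) l' by (auto dest: inj_onD)
      then have h: "h' < h" using ne hle by simp
      \<comment> \<open>The mirror image: all points of the line are to the right of
        \<open>i\<close>, and the next smaller free digit raises the value. If \<open>e = 0\<close>,
        the bound by \<open>ym\<close> compares the reversed high parts, which differ by
        injectivity.\<close>
      have "\<exists>d<w. crev w L i < crev w L (g d)"
      proof (cases "e = 0")
        case True
        have "crev w q h' \<noteq> crev w q h"
          using crev_inj[OF assms(1), of q] h h'less t(3) unfolding q_def by (auto dest: inj_onD)
        moreover have "crev w q h' \<le> crev w q h"
          using i(4) u True unfolding ym_def g_def ieq crev[OF e l'] crev[OF w0(1) t(4)] by simp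
        ultimately have "crev w L i < crev w L (g 0)"
          using u True unfolding g_def ieq crev[OF e l'] crev[OF w0(1) t(4)] by simp
        then show ?thesis using w0(1) by blast
      next
        case False
        then have e1: "e - 1 < w" "w - 1 - e < w - 1 - (e - 1)" using e by auto
        have "crev w L i < crev w L (g (e - 1))"
          using digit_less[OF e1(2) crev_less[OF assms(1)], of q h']
          unfolding g_def ieq crev[OF e l'] crev[OF e1(1) t(4)] u by simp
        then show ?thesis using e1(1) by blast
      qed
      then show ?thesis using x_lt[OF h] g by blast
    qed
  qed
qed

section \<open>Blowing up points to antichains\<close>

text \<open>The \<open>s\<close> copies of an index lie on the descending diagonal of its own
  \<open>s\<close> by \<open>s\<close> cell: they are mutually incomparable, while strict dominance
  between indices carries over to all their copies.\<close>

definition antichain_pt :: "nat \<Rightarrow> (nat \<Rightarrow> nat) \<Rightarrow> nat \<times> nat \<Rightarrow> real \<times> real" where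
  "antichain_pt s f = (\<lambda>(i, j). (real (s * i + j), real (s * f i + (s - 1 - j))))"

text \<open>A threshold at the upper end of a cell cuts through no cell, so a query with such a
  corner takes either all copies of an index or none.\<close>

lemma mult_add_le_iff_le:
  fixes i :: nat
  assumes "j < s"
  shows "s * i + j \<le> s * m + (s - 1) \<longleftrightarrow> i \<le> m"
proof
  assume "i \<le> m"
  then have "s * i \<le> s * m" by simp
  then show "s * i + j \<le> s * m + (s - 1)" using assms by linarith
next
  assume "s * i + j \<le> s * m + (s - 1)"
  then have "s * i < s * Suc m" using assms by simp
  then show "i \<le> m" by (metis mult_less_cancel1 less_Suc_eq_le)
qed

lemma mult_add_leD:
  fixes i :: nat
  assumes "j < s" "j' < s" "s * i + j \<le> s * i' + j'"
  shows "i \<le> i'"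
  using assms mult_add_le_iff_le[OF assms(1), of i i'] by linarith

lemma inj_antichain_pt: "inj_on (antichain_pt s f) (A \<times> {..<s})"
proof (rule inj_onI)
  fix u v assume uv: "u \<in> A \<times> {..<s}" "v \<in> A \<times> {..<s}" "antichain_pt s f u = antichain_pt s f v"
  obtain i j i' j' where [simp]: "u = (i, j)" "v = (i', j')" by (cases u, cases v)
  have "j < s" "j' < s" using uv by auto
  moreover have "s * i + j = s * i' + j'"
    using uv(3) unfolding antichain_pt_def by (simp del: of_nat_add of_nat_mult)
  ultimately show "u = v" using mult_add_leD[of j s j' i i'] mult_add_leD[of j' s j i' i] by simp
qed

lemma dominates_antichain_pt_le:
  assumes "j < s" "j' < s" "dominates (antichain_pt s f (i, j)) (antichain_pt s f (i', j'))"
  shows "i' \<le> i \<and> f i' \<le> f i \<and> i \<noteq> i'"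
proof -
  have a: "s * i' + j' \<le> s * i + j" "s * f i' + (s - 1 - j') \<le> s * f i + (s - 1 - j)" "(i, j) \<noteq> (i', j')"
    using assms(3) unfolding dominates_def antichain_pt_def
    by (auto simp del: of_nat_add of_nat_mult)
  moreover have "i' \<le> i" using mult_add_leD[OF assms(2,1) a(1)] .
  moreover have "f i' \<le> f i" using assms(1,2) mult_add_leD[OF _ _ a(2)] by simp
  ultimately show ?thesis using assms(1,2) by auto
qed

lemma dominates_antichain_pt:
  assumes "j < s" "j' < s" "i < i'" "f i < f i'"
  shows "dominates (antichain_pt s f (i', j')) (antichain_pt s f (i, j))"
proof -
  have "\<not> s * i' + j' \<le> s * i + j" using assms mult_add_leD[of j' s j i' i] by auto
  moreover have "\<not> s * f i' + (s - 1 - j') \<le> s * f i + (s - 1 - j)"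
    using assms mult_add_leD[of "s - 1 - j'" s "s - 1 - j" "f i'" "f i"] by auto
  ultimately show ?thesis unfolding dominates_def antichain_pt_def
    by (auto simp del: of_nat_add of_nat_mult)
qed

text \<open>The corner is scaled to the upper ends of its cells, with \<open>Z\<close> to the right
  of it. Indices outside \<open>I\<close> lose all their copies because \<open>dom\<close> is strict
  in both coordinates; copies of members of \<open>I\<close> survive by \<open>anti\<close>.\<close>

lemma range_skyline_antichain_pt:
  assumes "s > 0" "xm < N" "I \<subseteq> {..<N}"
    and le: "\<And>i. i \<in> I \<Longrightarrow> i \<le> xm \<and> f i \<le> ym"
    and anti: "\<And>i j. i \<in> I \<Longrightarrow> j \<in> I \<Longrightarrow> i < j \<Longrightarrow> f j < f i"
    and dom: "\<And>i. i < N \<Longrightarrow> i \<notin> I \<Longrightarrow> i \<le> xm \<Longrightarrow> f i \<le> ym \<Longrightarrow> \<exists>j\<in>I. i < j \<and> f i < f j"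
    and Z: "\<And>z. z \<in> Z \<Longrightarrow> real (s * N) \<le> fst z"
  shows "range_skyline (antichain_pt s f ` ({..<N} \<times> {..<s}) \<union> Z)
      (anti_dominance_range (real (s * xm + (s - 1))) (real (s * ym + (s - 1))))
    = antichain_pt s f ` (I \<times> {..<s})" (is "range_skyline ?P ?Q = _")
proof -
  define C where "C = {i. i < N \<and> i \<le> xm \<and> f i \<le> ym}"
  have IC: "I \<subseteq> C" using assms(3) le unfolding C_def by auto
  have Zout: "z \<notin> ?Q" if "z \<in> Z" for z
  proof -
    have "s * xm + (s - 1) < s * N"
      using mult_add_le_iff_le[of 0 s N xm] assms(1,2) by simp
    then have "real (s * xm + (s - 1)) < fst z"
      using Z[OF that] by (meson of_nat_less_iff order_less_le_trans)
    then show ?thesis unfolding anti_dominance_range_def by (auto simp: mem_Times_iff)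
  qed
  have in_iff: "antichain_pt s f (i, j) \<in> ?Q \<longleftrightarrow> i \<le> xm \<and> f i \<le> ym" if "j < s" for i j
    using mult_add_le_iff_le[OF that, of i xm] mult_add_le_iff_le[of "s - 1 - j" s "f i" ym] that
    unfolding antichain_pt_def anti_dominance_range_def
    by (simp del: of_nat_add of_nat_mult of_nat_diff)
  have PQ: "?P \<inter> ?Q = antichain_pt s f ` (C \<times> {..<s})"
    using Zout in_iff unfolding C_def by (auto simp del: of_nat_add of_nat_mult of_nat_diff)
  show ?thesis unfolding range_skyline_def PQ
  proof (intro equalityI subsetI)
    fix z assume z: "z \<in> skyline (antichain_pt s f ` (C \<times> {..<s}))"
    then obtain i j where ij: "z = antichain_pt s f (i, j)" "i \<in> C" "j < s"
      unfolding skyline_def by auto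
    have "i \<in> I"
    proof (rule ccontr)
      assume "i \<notin> I"
      then obtain i' where i': "i' \<in> I" "i < i'" "f i < f i'"
        using dom[of i] ij(2) unfolding C_def by auto
      then have "dominates (antichain_pt s f (i', j)) z"
        unfolding ij(1) using dominates_antichain_pt ij(3) by blast
      moreover have "antichain_pt s f (i', j) \<in> antichain_pt s f ` (C \<times> {..<s})"
        using i'(1) IC ij(3) by auto
      ultimately show False using z unfolding skyline_def by blast
    qed
    then show "z \<in> antichain_pt s f ` (I \<times> {..<s})" using ij by auto
  next
    fix z assume "z \<in> antichain_pt s f ` (I \<times> {..<s})"
    then obtain i j where ij: "z = antichain_pt s f (i, j)" "i \<in> I" "j < s" by auto
    have "\<not> dominates (antichain_pt s f (i', j')) z" if i': "i' \<in> C" "j' < s" for i' j'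
    proof
      assume "dominates (antichain_pt s f (i', j')) z"
      then have d: "i \<le> i'" "f i \<le> f i'" "i' \<noteq> i"
        using dominates_antichain_pt_le[OF i'(2) ij(3)] unfolding ij(1) by auto
      show False
      proof (cases "i' \<in> I")
        case True
        then show False using anti[OF ij(2) True] d by auto
      next
        case False
        \<comment> \<open>A dominating index outside \<open>I\<close> would itself lie strictly
          below some \<open>k\<close> in \<open>I\<close>, making two members of \<open>I\<close>
          comparable.\<close>
        then obtain k where "k \<in> I" "i' < k" "f i' < f k"
          using dom[of i'] i'(1) unfolding C_def by auto
        then show False using anti[OF ij(2), of k] d by auto
      qed
    qed
    then show "z \<in> skyline (antichain_pt s f ` (C \<times> {..<s}))"
      unfolding skyline_def using ij IC by auto
  qed
qed

section \<open>Lower bounds for the two readings\<close>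

text \<open>On an ascending chain, the query at the origin returns one point, which costs at least
  one block. For \<open>n = 0\<close> only the empty answer exists, hence the condition on
  \<open>f 0\<close>.\<close>

lemma lower_bound_small:
  assumes "f 1 \<le> 1" "f 0 \<le> 0 \<or> n > 0"
  shows "anti_dominance_lower_bound c B n f"
proof -
  define P where "P = (\<lambda>i. (real i, real i)) ` {..<n}"
  have card: "finite P" "card P = n"
    unfolding P_def by (auto simp: card_image inj_on_def)
  have "\<exists>\<alpha> \<beta>. let R = range_skyline P (anti_dominance_range \<alpha> \<beta>)
      in ereal (f (card R)) \<le> ereal_of_enat (io_cost D R)"
    if D: "indexability_structure B P D" for D
  proof (cases "n = 0")
    case True
    then have "f 0 \<le> 0" "P = {}" using assms card by auto
    then show ?thesis
      by (auto simp: range_skyline_def skyline_def Let_def intro!: io_cost_geI)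
  next
    case False
    have "P \<inter> anti_dominance_range 0 0 = {(0, 0)}"
      using False unfolding P_def anti_dominance_range_def by (auto simp: image_iff)
    then have "range_skyline P (anti_dominance_range 0 0) = {(0, 0)}"
      unfolding range_skyline_def skyline_def dominates_def by auto
    then show ?thesis using io_cost_ge_one[OF D, of "{(0,0)}" "f 1"] assms(1)
      by (intro exI[of _ 0]) (simp add: Let_def)
  qed
  then show ?thesis unfolding anti_dominance_lower_bound_def using card by blast
qed

text \<open>The input is a single antichain, and reporting all of it takes at least
  \<open>n / B\<close> blocks.\<close>

lemma lower_bound_staircase:
  assumes "f n \<le> real n / real B" "B > 0"
  shows "anti_dominance_lower_bound c B n f"
proof -
  define P where "P = (\<lambda>i. (real i, - real i)) ` {..<n}"
  have card: "finite P" "card P = n"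
    unfolding P_def by (auto simp: card_image inj_on_def)
  have "P \<inter> anti_dominance_range (real n) 0 = P"
    unfolding P_def anti_dominance_range_def by auto
  moreover have "skyline P = P" unfolding P_def skyline_def dominates_def by auto
  ultimately have R: "range_skyline P (anti_dominance_range (real n) 0) = P"
    unfolding range_skyline_def by simp
  have "ereal (f (card P)) \<le> ereal_of_enat (io_cost D P)" if "indexability_structure B P D" for D
    using io_cost_ge_div[OF that] assms card(2) by simp
  then have "\<exists>\<alpha> \<beta>. let R = range_skyline P (anti_dominance_range \<alpha> \<beta>)
      in ereal (f (card R)) \<le> ereal_of_enat (io_cost D R)" if "indexability_structure B P D" for D
    using that R by (metis (no_types, lifting))
  then show ?thesis unfolding anti_dominance_lower_bound_def using card by blast
qed

text \<open>\<open>(1 + 1 / w) ^ L\<close> is at most \<open>exp (L / w)\<close>, hence at most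
  \<open>exp 1\<close>. This limits to a factor 3 the loss from rounding \<open>n\<close> down to
  the form \<open>s * w ^ L\<close>.\<close>

lemma Suc_power_le:
  assumes "L \<le> w" "w > 0"
  shows "real ((w + 1) ^ L) \<le> 3 * real (w ^ L)"
proof -
  have "1 + 1 / real w \<le> exp (1 / real w)" by (rule exp_ge_add_one_self)
  then have "(1 + 1 / real w) ^ L \<le> exp (1 / real w) ^ L" by (intro power_mono) auto
  also have "\<dots> = exp (real L / real w)" by (simp flip: exp_of_nat_mult)
  also have "\<dots> \<le> exp 1" using assms by simp
  also have "\<dots> \<le> 3" by (rule exp_le)
  finally have "(1 + 1 / real w) ^ L * real w ^ L \<le> 3 * real w ^ L"
    by (intro mult_right_mono) auto
  moreover have "(1 + 1 / real w) * real w = real (w + 1)" using assms(2) by (simp add: field_simps)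
  ultimately show ?thesis by (simp flip: power_mult_distrib)
qed

text \<open>The threshold \<open>12 * c\<close> is the factor 4 of the double counting times the
  factor 3 of the rounding. The hypothesis on \<open>f\<close> is needed only at
  \<open>w * s\<close>, the common size of all the line queries.\<close>

lemma lower_bound_lines:
  fixes a c :: real
  assumes "c > 0" "12 * c < real L" "a > 0"
    and M: "8 * a < real M" "s * M\<^sup>2 \<le> B"
    and "s > 0" "L \<le> w"
    and n: "s * w ^ L \<le> n" "n < s * (w + 1) ^ L"
    and f: "f (w * s) \<le> 2 * a * real (w * s) / real B"
  shows "anti_dominance_lower_bound c B n f"
proof -
  have L: "L > 0" using assms(1,2) by (cases L) auto
  then have w: "w > 0" using assms by simp
  have B: "B > 0"
  proof -
    have "M > 0" using M(1) assms(3) by (cases M) auto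
    then have "s * M\<^sup>2 > 0" using assms(6) by simp
    then show ?thesis using M(2) by linarith
  qed
  define pt where "pt = antichain_pt s (crev w L)"
  \<comment> \<open>padding to \<open>n\<close> points, to the right of all queries used\<close>
  define Z where "Z = (\<lambda>i. (real (s * w ^ L + i), real i)) ` {..<n - s * w ^ L}"
  define P where "P = pt ` ({..<w ^ L} \<times> {..<s}) \<union> Z"
  define Q where "Q t = pt ` (line w t \<times> {..<s})" for t
  have inj: "inj_on pt (A \<times> {..<s})" for A unfolding pt_def by (rule inj_antichain_pt)
  have finP: "finite P" unfolding P_def Z_def by simp
  have cardP: "card P = n"
  proof -
    have "s * i + j < s * w ^ L" if "i < w ^ L" "j < s" for i j
      using digit_less[OF that] by (simp add: mult.commute)
    then have "pt ` ({..<w ^ L} \<times> {..<s}) \<inter> Z = {}"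
      unfolding pt_def antichain_pt_def Z_def
      by (auto simp del: of_nat_add of_nat_mult) (metis not_add_less1)
    moreover have "card Z = n - s * w ^ L"
      unfolding Z_def by (subst card_image) (auto simp: inj_on_def)
    moreover have "card (pt ` ({..<w ^ L} \<times> {..<s})) = s * w ^ L"
      by (subst card_image[OF inj]) (simp add: card_cartesian_product)
    ultimately show ?thesis
      unfolding P_def using n(1) by (subst card_Un_disjoint) (auto simp: Z_def)
  qed
  have cardQ: "card (Q t) = w * s" for t
    unfolding Q_def by (subst card_image[OF inj]) (simp add: card_cartesian_product card_line[OF w])
  have finQ: "finite (Q t)" for t unfolding Q_def using finite_line by simp
  have query: "\<exists>\<alpha> \<beta>. range_skyline P (anti_dominance_range \<alpha> \<beta>) = Q t" if t: "t \<in> lines w L" for t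
  proof -
    obtain xm ym where m: "xm < w ^ L"
      "\<And>i. i \<in> line w t \<Longrightarrow> i \<le> xm \<and> crev w L i \<le> ym"
      "\<And>i. i < w ^ L \<Longrightarrow> i \<notin> line w t \<Longrightarrow> i \<le> xm \<Longrightarrow> crev w L i \<le> ym \<Longrightarrow>
        \<exists>j\<in>line w t. i < j \<and> crev w L i < crev w L j"
      using line_maximal[OF w t] by metis
    have "range_skyline P (anti_dominance_range (real (s * xm + (s - 1))) (real (s * ym + (s - 1)))) = Q t"
      unfolding P_def Q_def pt_def
    proof (rule range_skyline_antichain_pt)
      show "real (s * w ^ L) \<le> fst z" if "z \<in> Z" for z
        using that unfolding Z_def by auto
    qed (use assms(6) m line_subset[OF w t] line_antichain[OF w t] in auto)
    then show ?thesis by blast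
  qed
  have inter: "card (Q t \<inter> Q t') \<le> s"
    if t: "t \<in> lines w L" "t' \<in> lines w L" "t \<noteq> t'" for t t'
  proof -
    let ?I = "line w t \<inter> line w t'"
    have "Q t \<inter> Q t' = pt ` (?I \<times> {..<s})"
      unfolding Q_def using inj_on_image_Int[OF inj[of UNIV], of "line w t \<times> {..<s}" "line w t' \<times> {..<s}"]
      by (auto simp: Times_Int_Times)
    then have "card (Q t \<inter> Q t') = card ?I * s"
      by (simp add: card_image[OF inj] card_cartesian_product)
    moreover have "card ?I \<le> 1"
      using line_Int[OF w t] finite_line by (metis One_nat_def card_le_Suc0_iff_eq finite_Int)
    ultimately show ?thesis by simp
  qed
  have "\<exists>\<alpha> \<beta>. let R = range_skyline P (anti_dominance_range \<alpha> \<beta>)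
      in ereal (f (card R)) \<le> ereal_of_enat (io_cost D R)"
    if D: "indexability_structure B P D" "real (card D) \<le> c * real n / real B" for D
  proof (rule ccontr)
    assume neg: "\<not> ?thesis"
    \<comment> \<open>Chosen so that \<open>2 * a * K / B\<close> blocks with fewer than
      \<open>\<tau>\<close> points each account for at most half of \<open>K = w * s\<close> points;
      \<open>8 * a < M\<close> then says exactly that \<open>M * \<tau>\<close> exceeds
      \<open>2 * B\<close>.\<close>
    define \<tau> where "\<tau> = real B / (4 * a)"
    have "\<exists>S\<subseteq>D. Q t \<subseteq> \<Union>S \<and> real (card S) * \<tau> \<le> real (w * s) / 2" if t: "t \<in> lines w L" for t
    proof -
      have "\<not> ereal (f (card (Q t))) \<le> ereal_of_enat (io_cost D (Q t))"
        using neg query[OF t] by (metis (no_types, lifting))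
      then obtain S where S: "S \<subseteq> D" "Q t \<subseteq> \<Union>S" "real (card S) < f (w * s)"
        using io_cost_geI[of D "Q t" "f (w * s)"] cardQ by (metis not_le)
      then have "real (card S) \<le> 2 * a * real (w * s) / real B" using f by linarith
      then have "real (card S) * \<tau> \<le> 2 * a * real (w * s) / real B * \<tau>"
        unfolding \<tau>_def using assms(3) by (intro mult_right_mono) auto
      also have "\<dots> = real (w * s) / 2" unfolding \<tau>_def using assms(3) B by simp
      finally show ?thesis using S by blast
    qed
    moreover have "2 * real B < real M * \<tau>"
      unfolding \<tau>_def using M(1) assms(3) B by (simp add: field_simps)
    moreover have "finite b \<and> card b \<le> B" if "b \<in> D" for b
      using D(1) that finP unfolding indexability_structure_def by (meson finite_subset)
    ultimately have "card (lines w L) * (w * s) \<le> 4 * B * card D"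
      using card_family_mult_le[OF finite_lines indexability_structure_finite[OF D(1)], where
          Q = Q and B = B and K = "w * s" and \<tau> = \<tau> and M = M and s = s]
        cardQ finQ inter M(2) by blast
    then have "real (card (lines w L) * (w * s)) \<le> real (4 * B * card D)" by (simp only: of_nat_le_iff)
    moreover have "card (lines w L) * (w * s) = L * (s * w ^ L)"
      using card_lines[of w L] by (simp flip: mult.assoc)
    ultimately have "real L * real (s * w ^ L) \<le> 4 * (real B * real (card D))" by simp
    also have "\<dots> \<le> 4 * (c * real n)" using D(2) B by (simp add: field_simps)
    also have "\<dots> \<le> 4 * (c * (3 * real (s * w ^ L)))"
    proof -
      have "real n \<le> real s * real ((w + 1) ^ L)"
        using n(2) by (metis less_imp_le of_nat_le_iff of_nat_mult)
      also have "\<dots> \<le> real s * (3 * real (w ^ L))"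
        using Suc_power_le[OF assms(7) w] by (intro mult_left_mono) auto
      finally show ?thesis using assms(1) by simp
    qed
    finally have "real L * real (s * w ^ L) \<le> 12 * c * real (s * w ^ L)" by simp
    moreover have "real (s * w ^ L) > 0" using assms(6) w by simp
    ultimately show False using assms(2) by (simp only: mult_le_cancel_right_pos)
  qed
  then show ?thesis unfolding anti_dominance_lower_bound_def using finP cardP by blast
qed

lemma powr_inverse_le:
  assumes "x \<le> y ^ L" "0 \<le> x" "0 < y" "L > 0"
  shows "x powr (1 / real L) \<le> y"
proof -
  have "x powr (1 / real L) \<le> (y ^ L) powr (1 / real L)"
    using assms by (intro powr_mono2) auto
  also have "\<dots> = y"
    using assms by (simp add: powr_powr flip: powr_realpow)
  finally show ?thesis .
qed

lemma lower_bound_output_sensitive: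
  fixes a c :: real
  assumes "c > 0" "12 * c < real L" "a > 0"
  shows "\<exists>\<gamma>>0. \<exists>B\<^sub>0\<ge>1. \<forall>B\<ge>B\<^sub>0. \<forall>n. anti_dominance_lower_bound c B n
        (\<lambda>k. \<gamma> * (real n / real B) powr (1 / real L) + a * (real k / real B))"
proof -
  have L: "L > 0" using assms(1,2) by (cases L) auto
  define M where "M = nat \<lceil>8 * a\<rceil> + 1"
  have M: "8 * a < real M" "M > 0" unfolding M_def by linarith+
  \<comment> \<open>The first entry serves large \<open>w\<close>: 3 comes from
    \<open>(n / B) powr (1 / L) \<le> 3 * w\<close>, and 2 with the square of \<open>M\<close> from
    \<open>B \<le> 2 * s * M\<^sup>2\<close>. The second serves \<open>w < L\<close>, where that
    power is at most \<open>L\<close>.\<close>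
  define \<gamma> where "\<gamma> = min (a / (6 * (real M)\<^sup>2)) (1 / (2 * real L))"
  have \<gamma>: "\<gamma> > 0" "\<gamma> \<le> a / (6 * (real M)\<^sup>2)" "\<gamma> \<le> 1 / (2 * real L)"
    unfolding \<gamma>_def using assms(3) L M by auto
  have "anti_dominance_lower_bound c B n
      (\<lambda>k. \<gamma> * (real n / real B) powr (1 / real L) + a * (real k / real B))"
    if B: "B \<ge> M\<^sup>2" for B n
  proof -
    define s where "s = B div M\<^sup>2"
    have s: "s > 0" "s * M\<^sup>2 \<le> B" "s \<le> B"
      unfolding s_def using B M by (auto simp: div_greater_zero_iff)
    have B0: "B > 0" using s by simp
    have "B < (s + 1) * M\<^sup>2"
      unfolding s_def using M(2) dividend_less_div_times[of "M\<^sup>2" B] by simp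
    also have "\<dots> \<le> (2 * s) * M\<^sup>2" using s(1) by (intro mult_le_mono1) simp
    finally have sB: "real B \<le> 2 * real s * (real M)\<^sup>2"
      by (metis less_imp_le of_nat_le_iff of_nat_mult of_nat_numeral of_nat_power)
    define w where "w = (GREATEST w. s * w ^ L \<le> n)"
    \<comment> \<open>Bounds the candidates for \<open>w\<close>, so that the greatest one
      exists.\<close>
    have bound: "v \<le> n" if "s * v ^ L \<le> n" for v
    proof -
      have "v \<le> v ^ L" using L by (cases "v = 0") (auto intro: self_le_power)
      also have "\<dots> \<le> s * v ^ L" using s(1) by simp
      finally show ?thesis using that by simp
    qed
    have w1: "s * w ^ L \<le> n" unfolding w_def
      by (rule GreatestI_nat[where k = 0 and b = n]) (use bound L in \<open>auto simp: zero_power\<close>)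
    have w2: "n < s * (w + 1) ^ L"
    proof (rule ccontr)
      assume "\<not> n < s * (w + 1) ^ L"
      then have "w + 1 \<le> w"
        unfolding w_def by (intro Greatest_le_nat[where b = n]) (use bound in \<open>auto simp: not_less\<close>)
      then show False by simp
    qed
    show ?thesis
    proof (cases "L \<le> w")
      case False
      \<comment> \<open>For \<open>w < L\<close> the ratio \<open>n / B\<close> is bounded, so both
        terms are at most \<open>1 / 2\<close> at \<open>k = 1\<close> and a one-point answer
        suffices.\<close>
      have "n \<le> B * L ^ L"
      proof -
        have "n \<le> s * (w + 1) ^ L" using w2 by simp
        also have "\<dots> \<le> B * L ^ L" using False s(3) by (intro mult_le_mono power_mono) auto
        finally show ?thesis .
      qed
      then have "real n / real B \<le> real L ^ L"
        using B0 by (simp add: divide_le_eq mult.commute flip: of_nat_power of_nat_mult)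
      then have "(real n / real B) powr (1 / real L) \<le> real L"
        using L by (intro powr_inverse_le) auto
      then have "\<gamma> * (real n / real B) powr (1 / real L) \<le> 1 / (2 * real L) * real L"
        using \<gamma> by (intro mult_mono) auto
      then have "\<gamma> * (real n / real B) powr (1 / real L) \<le> 1 / 2" using L by simp
      moreover have "a * (real 1 / real B) \<le> 1 / 2"
      proof -
        have "2 * a \<le> real M" using M(1) assms(3) by linarith
        also have "\<dots> \<le> real B"
          using B M(2) by (metis dual_order.trans of_nat_le_iff power2_nat_le_imp_le self_le_power pos2 Suc_leI One_nat_def)
        finally show ?thesis using B0 by (simp add: field_simps)
      qed
      ultimately have "\<gamma> * (real n / real B) powr (1 / real L) + a * (real 1 / real B) \<le> 1"
        by linarith
      then show ?thesis by (rule lower_bound_small) (cases "n = 0"; simp)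
    next
      case True
      have w: "w > 0" using True L by simp
      have "real n \<le> real s * real ((w + 1) ^ L)"
        using w2 by (metis less_imp_le of_nat_le_iff of_nat_mult)
      also have "\<dots> \<le> real B * (3 * real (w ^ L))"
        using Suc_power_le[OF True w] s(3) by (intro mult_mono) auto
      finally have "real n / real B \<le> 3 * real w ^ L" using B0 by (simp add: divide_le_eq mult.commute)
      also have "\<dots> \<le> (3 * real w) ^ L"
        using L self_le_power[of "3::real" L] by (simp add: power_mult_distrib mult_right_mono)
      finally have "(real n / real B) powr (1 / real L) \<le> 3 * real w"
        using L w by (intro powr_inverse_le) auto
      then have "\<gamma> * (real n / real B) powr (1 / real L) \<le> a / (6 * (real M)\<^sup>2) * (3 * real w)"
        using \<gamma> assms(3) by (intro mult_mono) auto
      also have "\<dots> = a * real w * (1 / (2 * (real M)\<^sup>2))" by simp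
      also have "\<dots> \<le> a * real w * (real s / real B)"
        using sB B0 M(2) assms(3) by (intro mult_left_mono) (simp_all add: field_simps)
      finally have "\<gamma> * (real n / real B) powr (1 / real L) \<le> a * (real (w * s) / real B)"
        by (simp add: mult.commute mult.left_commute)
      \<comment> \<open>For a line query the polynomial term is at most the output term, so their
        sum stays within the \<open>2 * a * k / B\<close> that \<open>lower_bound_lines\<close>
        allows.\<close>
      then have "\<gamma> * (real n / real B) powr (1 / real L) + a * (real (w * s) / real B)
          \<le> 2 * (a * (real (w * s) / real B))"
        unfolding mult_2 by (rule add_right_mono)
      then show ?thesis
        using lower_bound_lines[OF assms M(1) s(2,1) True w1 w2] by simp
    qed
  qed
  moreover have "M\<^sup>2 \<ge> 1" using M(2) by simp
  ultimately show ?thesis using \<gamma>(1) by blast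
qed

text \<open>For \<open>n < B\<close> both terms are at most 1 at \<open>k = 1\<close>, so a
  one-point answer suffices. Otherwise \<open>\<epsilon> \<le> 1\<close> makes the power at most
  \<open>n / B\<close>, the cost of reporting a full staircase.\<close>

lemma lower_bound_single_constant:
  assumes "0 < \<epsilon>" "\<epsilon> \<le> 1" "B > 0"
  shows "anti_dominance_lower_bound c B n
    (\<lambda>k. 1 / 2 * ((real n / real B) powr \<epsilon> + real k / real B))"
proof (cases "n < B")
  case True
  have "(real n / real B) powr \<epsilon> \<le> 1 powr \<epsilon>" using True assms(1) by (intro powr_mono2) auto
  moreover have "real 1 / real B \<le> 1" using assms(3) by simp
  ultimately show ?thesis by (intro lower_bound_small) auto
next
  case False
  then have "(real n / real B) powr \<epsilon> \<le> (real n / real B) powr 1"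
    using assms by (intro powr_mono) auto
  then show ?thesis using assms(3) by (intro lower_bound_staircase) (auto simp: field_simps)
qed

theorem theorem5:
  fixes c :: real
  assumes "c \<ge> 1"
  shows "\<exists>\<epsilon>>0.
    (\<exists>\<gamma>>0. \<forall>B\<ge>1. \<forall>n. anti_dominance_lower_bound c B n
        (\<lambda>k. \<gamma> * ((real n / real B) powr \<epsilon> + real k / real B))) \<and>
    (\<forall>a>0. \<exists>\<gamma>>0. \<exists>B\<^sub>0\<ge>1. \<forall>B\<ge>B\<^sub>0. \<forall>n. anti_dominance_lower_bound c B n
        (\<lambda>k. \<gamma> * (real n / real B) powr \<epsilon> + a * (real k / real B)))"
proof -
  \<comment> \<open>\<open>L\<close> depends on \<open>c\<close> alone, so the exponent
    \<open>1 / L\<close> serves both readings and every \<open>a\<close>.\<close>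
  define L where "L = nat \<lceil>12 * c\<rceil> + 1"
  have L: "12 * c < real L" "L \<ge> 1" unfolding L_def by linarith+
  show ?thesis
  proof (rule exI[of _ "1 / real L"], intro conjI)
    show "\<exists>\<gamma>>0. \<forall>B\<ge>1. \<forall>n. anti_dominance_lower_bound c B n
        (\<lambda>k. \<gamma> * ((real n / real B) powr (1 / real L) + real k / real B))"
      using L(2) by (intro exI[of _ "1 / 2"] conjI allI impI lower_bound_single_constant) (auto simp: field_simps)
    show "\<forall>a>0. \<exists>\<gamma>>0. \<exists>B\<^sub>0\<ge>1. \<forall>B\<ge>B\<^sub>0. \<forall>n. anti_dominance_lower_bound c B n
        (\<lambda>k. \<gamma> * (real n / real B) powr (1 / real L) + a * (real k / real B))"
      using lower_bound_output_sensitive[of c L] L(1) assms by auto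
  qed (use L in auto)
qed

end
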